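(* Let $S$ be the singular inner function defined by $S(z)=\exp\left(-\frac{1+z}{1-z}\right)$, $z\in\mathbb{D}$, and let $f$ be an analytic function in $\mathbb{D}$ satisfying: (i) $\lim_{z\to 1}|f(z)|=\infty$ (limit as $z\to 1$, $z\in\mathbb{D}$); (ii) $|f(r)|=o\left(\exp\frac{1+r}{1-r}\right)$ as $r\to 1^-$ ($r$ real, $0<r<1$). Then the function $F$ defined by $F(z)=S(z)f(z)$, $z\in\mathbb{D}$, is not a normal function (hence, it is not a Bloch function).
   Context: $\mathbb{D}=\{z\in\mathbb{C}:|z|<1\}$ is the open unit disc. A function $f$ analytic in $\mathbb{D}$ is a Bloch function if $|f(0)|+\sup_{z\in\mathbb{D}}(1-|z|^2)|f'(z)|<\infty$. A function $f$ meromorphic in $\mathbb{D}$ is a normal function (in the sense of Lehto and Virtanen) if $\sup_{z\in\mathbb{D}}(1-|z|^2)\frac{|f'(z)|}{1+|f(z)|^2}<\infty$; here this is applied to the analytic function $F$. *)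

theory Defs
  imports "HOL-Complex_Analysis.Complex_Analysis" "HOL-Library.Landau_Symbols"
begin

abbreviation unit_disc :: "complex set" where
  "unit_disc \<equiv> ball 0 1"

definition bloch_function :: "(complex \<Rightarrow> complex) \<Rightarrow> bool" where
  "bloch_function f \<longleftrightarrow> f holomorphic_on unit_disc \<and>
     ennreal (cmod (f 0)) + (SUP z\<in>unit_disc. ennreal ((1 - (cmod z)\<^sup>2) * cmod (deriv f z))) < \<infinity>"

text \<open>
  The predicate meromorphic_on allows arbitrary values at poles and at removable
  singularities, where the spherical derivative is understood as its continuous extension.
  These points are isolated, so restricting the supremum to the points of analyticity does
  not change its value. For a function holomorphic on the disc the restriction is vacuous.
\<close>

definition normal_function :: "(complex \<Rightarrow> complex) \<Rightarrow> bool" where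
  "normal_function f \<longleftrightarrow> f meromorphic_on unit_disc \<and>
     (SUP z\<in>{z \<in> unit_disc. f analytic_on {z}}.
        ennreal ((1 - (cmod z)\<^sup>2) * (cmod (deriv f z) / (1 + (cmod (f z))\<^sup>2)))) < \<infinity>"

definition singular_inner :: "complex \<Rightarrow> complex" where
  "singular_inner z = exp (- ((1 + z) / (1 - z)))"

end

theory Submission
  imports Defs
begin

text \<open>
  Put \<open>w = (1 + z) / (1 - z)\<close> and \<open>g(w) = f(z)\<close>, so that \<open>F(z) = exp(-w) g(w)\<close> on the right
  half-plane. Given \<open>M\<close>, there is \<open>R\<close> with \<open>|g| > exp M\<close> on the part where \<open>|w| > R\<close>, and there the
  Schwarz--Pick inequality for \<open>log g - M\<close>, which has positive real part, gives
  \<open>|g'/g| \<le> (log|g| - M) / Re w\<close> up to a factor \<open>1 + O(R\<^sup>2 / |w|\<^sup>2)\<close>. Since \<open>F\<close> is small on the real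
  axis and large on the line \<open>Re w = 1\<close>, there are points with \<open>|w|\<close> arbitrarily large and
  \<open>|F| = 1\<close>, that is, \<open>log|g| = Re w\<close>. At such a point
  \<open>Re w |g'/g - 1| \<ge> M - O(R\<^sup>2 / |w|)\<close>, and the left-hand side is exactly
  \<open>(1 - |z|\<^sup>2) |F'(z)| / (1 + |F(z)|\<^sup>2)\<close>. As \<open>M\<close> is arbitrary, this quantity is unbounded.
\<close>

section \<open>Schwarz-Pick bounds for the logarithmic derivative\<close>

text \<open>Schwarz's lemma applied to \<open>h\<close>: the Moebius map taking the right half-plane
  to the disc and \<open>p 0\<close> to 0 makes \<open>p\<close> a self-map of the disc that fixes
  0, with derivative \<open>deriv p 0 / (2 * Re (p 0))\<close> there.\<close>

lemma deriv_bound_Re_pos: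
  assumes p: "p holomorphic_on ball 0 1" and pos: "\<And>z. z \<in> ball 0 1 \<Longrightarrow> Re (p z) > 0"
  shows "cmod (deriv p 0) \<le> 2 * Re (p 0)"
proof -
  define h where "h = (\<lambda>z. (p z - p 0) / (p z + cnj (p 0)))"
  have p0: "Re (p 0) > 0" using pos by simp
  have nz: "p z + cnj (p 0) \<noteq> 0" if "z \<in> ball 0 1" for z
    using pos[OF that] p0 by (auto simp: complex_eq_iff)
  have holh: "h holomorphic_on ball 0 1"
    unfolding h_def using nz by (intro holomorphic_intros p) auto
  have lt: "cmod (h z) < 1" if "cmod z < 1" for z
  proof -
    have z: "z \<in> ball 0 1" using that by simp
    \<comment> \<open>Geometrically, \<open>p z\<close> lies closer to \<open>p 0\<close> than to
      its mirror image \<open>- cnj (p 0)\<close> in the imaginary axis.\<close>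
    have "(cmod (p z + cnj (p 0)))\<^sup>2 - (cmod (p z - p 0))\<^sup>2 = 4 * (Re (p z) * Re (p 0))"
      unfolding cmod_power2 by (simp add: power2_eq_square algebra_simps)
    moreover have "Re (p z) * Re (p 0) > 0" using pos[OF z] p0 by simp
    ultimately have "(cmod (p z - p 0))\<^sup>2 < (cmod (p z + cnj (p 0)))\<^sup>2" by linarith
    then have "cmod (p z - p 0) < cmod (p z + cnj (p 0))" by (rule power2_less_imp_less) simp
    then show ?thesis using nz[OF z] by (simp add: h_def norm_divide)
  qed
  have "cmod (deriv h 0) \<le> 1"
    by (rule Schwarz_Lemma(2)[OF holh _ lt, of 0]) (auto simp: h_def)
  moreover have "deriv h 0 = deriv p 0 / (p 0 + cnj (p 0))"
  proof (rule DERIV_imp_deriv)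
    have d: "(p has_field_derivative deriv p 0) (at 0)"
      by (rule holomorphic_derivI[OF p]) auto
    show "(h has_field_derivative deriv p 0 / (p 0 + cnj (p 0))) (at 0)"
      unfolding h_def using nz[of 0]
      by (auto intro!: derivative_eq_intros d simp: power2_eq_square)
  qed
  moreover have "p 0 + cnj (p 0) = of_real (2 * Re (p 0))" by (simp add: complex_eq_iff)
  ultimately show ?thesis using p0 by (simp add: norm_divide norm_mult field_simps)
qed

text \<open>A zero-free function on the disc has a holomorphic logarithm \<open>l\<close>, with
  derivative \<open>k' / k\<close>. The lower bound on \<open>k\<close> says that
  \<open>l - ln K\<close> has positive real part, so the previous estimate applies to it.\<close>

lemma log_deriv_bound_disc:
  assumes k: "k holomorphic_on ball 0 1" and "K > 0"
    and big: "\<And>z. z \<in> ball 0 1 \<Longrightarrow> cmod (k z) > K"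
  shows "cmod (deriv k 0 / k 0) \<le> 2 * (ln (cmod (k 0)) - ln K)"
proof -
  have nz: "k z \<noteq> 0" if "z \<in> ball 0 1" for z using big[OF that] \<open>K > 0\<close> by auto
  obtain l where l: "l holomorphic_on ball 0 1" and kl: "\<And>z. z \<in> ball 0 1 \<Longrightarrow> k z = exp (l z)"
    using contractible_imp_holomorphic_log[OF k convex_imp_contractible[OF convex_ball] nz] by blast
  have Re_l: "Re (l z) = ln (cmod (k z))" if "z \<in> ball 0 1" for z
    using kl[OF that] by simp
  have d: "(l has_field_derivative deriv l 0) (at 0)"
    by (rule holomorphic_derivI[OF l]) auto
  have "((\<lambda>z. exp (l z)) has_field_derivative exp (l 0) * deriv l 0) (at 0)"
    by (auto intro!: derivative_eq_intros d)
  then have "(k has_field_derivative exp (l 0) * deriv l 0) (at 0)"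
    by (rule has_field_derivative_transform_within_open[of _ _ _ "ball 0 1"]) (auto simp: kl)
  then have "deriv k 0 = exp (l 0) * deriv l 0" by (rule DERIV_imp_deriv)
  then have "deriv k 0 / k 0 = deriv l 0" by (simp add: kl)
  moreover have "deriv (\<lambda>z. l z - of_real (ln K)) 0 = deriv l 0"
    by (rule DERIV_imp_deriv) (auto intro!: derivative_eq_intros d)
  moreover have "cmod (deriv (\<lambda>z. l z - of_real (ln K)) 0) \<le> 2 * Re (l 0 - of_real (ln K))"
  proof (rule deriv_bound_Re_pos)
    show "Re (l z - of_real (ln K)) > 0" if "z \<in> ball 0 1" for z
      using ln_strict_mono[OF big[OF that] \<open>K > 0\<close>] Re_l[OF that] by simp
  qed (intro holomorphic_intros l)
  ultimately show ?thesis using Re_l[of 0] by simp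
qed

text \<open>Transported from the disc by \<open>\<sigma>\<close>, which maps it conformally onto the
  half-plane with \<open>\<sigma> 0 = s\<close>. Its derivative \<open>2 * Re s\<close> at 0
  supplies the denominator and cancels the factor 2.\<close>

lemma log_deriv_bound_half_plane:
  assumes k: "k holomorphic_on {s. Re s > 0}" and "K > 0"
    and big: "\<And>s. Re s > 0 \<Longrightarrow> cmod (k s) > K" and s: "Re s > 0"
  shows "cmod (deriv k s / k s) \<le> (ln (cmod (k s)) - ln K) / Re s"
proof -
  define \<sigma> where "\<sigma> = (\<lambda>z. \<i> * of_real (Im s) + of_real (Re s) * ((1 + z) / (1 - z)))"
  have \<sigma>0: "\<sigma> 0 = s" by (simp add: \<sigma>_def complex_eq_iff)
  have Re_\<sigma>: "Re (\<sigma> z) > 0" if "z \<in> ball 0 1" for z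
  proof -
    have "Re ((1 + z) / (1 - z)) = (1 - (cmod z)\<^sup>2) / (cmod (1 - z))\<^sup>2"
      unfolding Re_divide cmod_power2 by (simp add: power2_eq_square algebra_simps)
    moreover have "z \<noteq> 1" "(cmod z)\<^sup>2 < 1" using that by (auto simp: abs_square_less_1)
    ultimately have "Re ((1 + z) / (1 - z)) > 0" by simp
    moreover have "Re (\<sigma> z) = Re s * Re ((1 + z) / (1 - z))"
      unfolding \<sigma>_def plus_complex.sel Re_complex_of_real Re_i_times Im_complex_of_real
        times_complex.sel by simp
    ultimately show ?thesis using s by simp
  qed
  have hol\<sigma>: "\<sigma> holomorphic_on ball 0 1"
    unfolding \<sigma>_def by (intro holomorphic_intros) auto
  have holk: "(k \<circ> \<sigma>) holomorphic_on ball 0 1"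
    by (rule holomorphic_on_compose_gen[OF hol\<sigma> k]) (use Re_\<sigma> in auto)
  have d\<sigma>: "(\<sigma> has_field_derivative 2 * of_real (Re s)) (at 0)"
    unfolding \<sigma>_def by (auto intro!: derivative_eq_intros)
  have dk: "(k has_field_derivative deriv k s) (at (\<sigma> 0))"
    unfolding \<sigma>0 by (rule holomorphic_derivI[OF k open_halfspace_Re_gt]) (use s in auto)
  have "deriv (k \<circ> \<sigma>) 0 = deriv k s * (2 * of_real (Re s))"
    by (rule DERIV_imp_deriv, rule DERIV_chain[OF dk d\<sigma>])
  moreover have "cmod (deriv (k \<circ> \<sigma>) 0 / (k \<circ> \<sigma>) 0) \<le> 2 * (ln (cmod ((k \<circ> \<sigma>) 0)) - ln K)"
    by (rule log_deriv_bound_disc[OF holk \<open>K > 0\<close>]) (use big Re_\<sigma> in auto)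
  ultimately have "2 * (Re s * cmod (deriv k s / k s)) \<le> 2 * (ln (cmod (k s)) - ln K)"
    using s by (simp add: \<sigma>0 norm_divide norm_mult ac_simps)
  then have "Re s * cmod (deriv k s / k s) \<le> ln (cmod (k s)) - ln K"
    by (rule mult_left_le_imp_le) simp
  then show ?thesis using s by (simp add: pos_le_divide_eq mult.commute)
qed

text \<open>
  The map \<open>w \<mapsto> w - R\<^sup>2 / w\<close> sends the half-plane without the disc conformally onto the
  half-plane; \<open>v\<close> below is its inverse.
\<close>

lemma log_deriv_bound_half_plane_minus_disc:
  fixes R K :: real
  defines "\<Omega> \<equiv> {w. Re w > 0 \<and> cmod w > R}"
  assumes g: "g holomorphic_on \<Omega>" and "K > 0" and "R > 0"
    and big: "\<And>w. w \<in> \<Omega> \<Longrightarrow> cmod (g w) > K" and w: "w \<in> \<Omega>"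
  defines "q \<equiv> R\<^sup>2 / (cmod w)\<^sup>2"
  shows "cmod (deriv g w / g w) \<le> (ln (cmod (g w)) - ln K) / Re w * ((1 + q) / (1 - q))"
proof -
  have op: "open \<Omega>" unfolding \<Omega>_def
    by (intro open_Collect_conj open_Collect_less continuous_intros)
  \<comment> \<open>A root of \<open>v^2 - s v - R^2 = 0\<close>. The principal square root has
    nonnegative real part, which makes \<open>Re (v s)\<close> positive.\<close>
  define v where "v = (\<lambda>s. (s + csqrt (s\<^sup>2 + 4 * of_real (R\<^sup>2))) / 2)"
  have noneg: "s\<^sup>2 + 4 * of_real (R\<^sup>2) \<notin> \<real>\<^sub>\<le>\<^sub>0" if "Re s > 0" for s
  proof
    assume "s\<^sup>2 + 4 * of_real (R\<^sup>2) \<in> \<real>\<^sub>\<le>\<^sub>0"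
    then have *: "Im (s\<^sup>2) = 0" "Re (s\<^sup>2) + 4 * R\<^sup>2 \<le> 0"
      by (auto simp: complex_nonpos_Reals_iff)
    from *(1) that have "Im s = 0" by (simp add: power2_eq_square)
    with *(2) that \<open>R > 0\<close> show False
      by (smt (verit) Re_power2 zero_less_power2 power_zero_numeral)
  qed
  have holv: "v holomorphic_on {s. Re s > 0}"
    unfolding v_def using noneg by (intro holomorphic_intros) auto
  have Re_v: "Re (v s) > 0" if "Re s > 0" for s
    using that Re_csqrt[of "s\<^sup>2 + 4 * of_real (R\<^sup>2)"] by (simp add: v_def del: csqrt.simps)
  have v_eq: "v s - of_real (R\<^sup>2) / v s = s" if "Re s > 0" for s
  proof -
    have "2 * v s - s = csqrt (s\<^sup>2 + 4 * of_real (R\<^sup>2))"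
      by (simp add: v_def diff_eq_eq add.commute del: csqrt.simps of_real_power)
    then have "(2 * v s - s)\<^sup>2 = s\<^sup>2 + 4 * of_real (R\<^sup>2)" by simp
    then have "4 * (v s * v s - of_real (R\<^sup>2)) = 4 * (s * v s)"
      by (simp add: power2_eq_square algebra_simps)
    then have "v s * v s - of_real (R\<^sup>2) = s * v s"
      by (subst (asm) mult_cancel_left) simp
    moreover have "v s \<noteq> 0" using Re_v[OF that] by auto
    ultimately show ?thesis by (simp add: field_simps)
  qed
  have Re_s: "Re (w - of_real (R\<^sup>2) / w) = Re w * (1 - R\<^sup>2 / (cmod w)\<^sup>2)" for w
    unfolding minus_complex.sel Re_divide cmod_power2 
    by (simp add: right_diff_distrib power2_eq_square)
  \<comment> \<open>By \<open>Re_s\<close>, if \<open>v\<close> and \<open>v - R^2 / v\<close> both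
    have positive real part, then \<open>|v| > R\<close>.\<close>
  have v\<Omega>: "v s \<in> \<Omega>" if "Re s > 0" for s
  proof -
    have "0 < Re (v s) * (1 - R\<^sup>2 / (cmod (v s))\<^sup>2)"
      using Re_s[of "v s"] unfolding v_eq[OF that] using that by linarith
    then have "R\<^sup>2 / (cmod (v s))\<^sup>2 < 1" using Re_v[OF that] by (simp add: zero_less_mult_iff)
    moreover have "v s \<noteq> 0" using Re_v[OF that] by auto
    ultimately have "R\<^sup>2 < (cmod (v s))\<^sup>2" by (simp add: field_simps)
    then have "R < cmod (v s)" by (rule power2_less_imp_less) simp
    then show ?thesis using Re_v[OF that] by (simp add: \<Omega>_def)
  qed
  have w0: "Re w > 0" "R < cmod w" "w \<noteq> 0" using w by (auto simp: \<Omega>_def)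
  have "R\<^sup>2 < (cmod w)\<^sup>2" using w0 \<open>R > 0\<close> by (intro power_strict_mono) auto
  then have q: "0 \<le> q" "q < 1" using w0 by (auto simp: q_def field_simps)
  define s where "s = w - of_real (R\<^sup>2) / w"
  have s: "Re s = Re w * (1 - q)" unfolding s_def Re_s q_def ..
  then have spos: "Re s > 0" using w0 q by simp
  \<comment> \<open>Both \<open>v s\<close> and \<open>w\<close> solve the same quadratic. Its roots
    have product \<open>- R^2\<close>, so the root other than \<open>w\<close> is
    \<open>- R^2 / w\<close>, which has negative real part.\<close>
  have vs: "v s = w"
  proof -
    have vnz: "v s \<noteq> 0" using Re_v[OF spos] by auto
    have "(v s - w) * (v s * w + of_real (R\<^sup>2)) = 0"
      using v_eq[OF spos] vnz w0(3) unfolding s_def by (simp add: field_simps)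
    moreover have "v s * w + of_real (R\<^sup>2) \<noteq> 0"
    proof
      assume "v s * w + of_real (R\<^sup>2) = 0"
      then have "v s = - of_real (R\<^sup>2) / w" using w0 by (simp add: field_simps add_eq_0_iff)
      then have "Re (v s) = - R\<^sup>2 * Re w / (cmod w)\<^sup>2"
        by (simp add: Re_divide cmod_power2)
      moreover have "R\<^sup>2 * Re w / (cmod w)\<^sup>2 \<ge> 0" using w0 by simp
      ultimately show False using Re_v[OF spos] by simp
    qed
    ultimately show ?thesis by simp
  qed
  have dv: "(v has_field_derivative deriv v s) (at s)"
    by (rule holomorphic_derivI[OF holv open_halfspace_Re_gt]) (use spos in auto)
  \<comment> \<open>Differentiating the identity \<open>v - R^2 / v = s\<close> bounds
    \<open>|v'|\<close> below by \<open>1 / (1 + q)\<close>. This gives the numerator of the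
    distortion factor; \<open>1 - q\<close> comes from \<open>Re s\<close>.\<close>
  have "((\<lambda>s. v s - of_real (R\<^sup>2) / v s) has_field_derivative
      deriv v s * (1 + of_real (R\<^sup>2) / w\<^sup>2)) (at s)"
    using w0(3) by (auto intro!: derivative_eq_intros dv simp: vs power2_eq_square algebra_simps)
  then have "((\<lambda>s. s) has_field_derivative deriv v s * (1 + of_real (R\<^sup>2) / w\<^sup>2)) (at s)"
    by (rule has_field_derivative_transform_within_open[OF _ open_halfspace_Re_gt[of 0]])
      (use spos v_eq in auto)
  then have one: "deriv v s * (1 + of_real (R\<^sup>2) / w\<^sup>2) = 1"
    using DERIV_ident DERIV_unique by blast
  have "cmod (1 + of_real (R\<^sup>2) / w\<^sup>2) \<le> 1 + q"
    using norm_triangle_ineq[of 1 "of_real (R\<^sup>2) / w\<^sup>2"]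
    by (simp add: q_def norm_divide norm_power)
  then have dv_lower: "1 \<le> cmod (deriv v s) * (1 + q)"
    using arg_cong[OF one, of cmod] by (metis norm_mult norm_one mult_left_mono norm_ge_zero)
  have dg: "(g has_field_derivative deriv g w) (at (v s))"
    unfolding vs by (rule holomorphic_derivI[OF g op w])
  have dgv: "deriv (g \<circ> v) s = deriv g w * deriv v s"
    by (rule DERIV_imp_deriv, rule DERIV_chain[OF dg dv])
  have "cmod (deriv (g \<circ> v) s / (g \<circ> v) s) \<le> (ln (cmod ((g \<circ> v) s)) - ln K) / Re s"
  proof (rule log_deriv_bound_half_plane)
    show "(g \<circ> v) holomorphic_on {s. Re s > 0}"
      by (rule holomorphic_on_compose_gen[OF holv g]) (use v\<Omega> in auto)
  qed (use \<open>K > 0\<close> big v\<Omega> spos in auto)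
  then have "cmod (deriv g w / g w) * cmod (deriv v s) \<le> (ln (cmod (g w)) - ln K) / (Re w * (1 - q))"
    by (simp add: dgv vs s norm_mult norm_divide)
  then have "cmod (deriv g w / g w) * cmod (deriv v s) * (1 + q)
      \<le> (ln (cmod (g w)) - ln K) / (Re w * (1 - q)) * (1 + q)"
    using q by (intro mult_right_mono) auto
  moreover have "cmod (deriv g w / g w) * 1 \<le> cmod (deriv g w / g w) * (cmod (deriv v s) * (1 + q))"
    by (intro mult_left_mono dv_lower norm_ge_zero)
  ultimately show ?thesis by (simp add: mult.assoc)
qed


section \<open>The Cayley transform from the half-plane to the disc\<close>

text \<open>The inverse of \<open>z \<mapsto> (1 + z) / (1 - z)\<close>; in the variable
  \<open>w\<close> the singular inner function becomes \<open>exp (- w)\<close>.\<close>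

definition cayley :: "complex \<Rightarrow> complex" where
  "cayley w = (w - 1) / (w + 1)"

lemma cayley_inverse:
  assumes "Re w > 0"
  shows "(1 + cayley w) / (1 - cayley w) = w"
proof -
  have "w + 1 \<noteq> 0" using assms by (auto simp: complex_eq_iff)
  then have "1 + cayley w = 2 * w / (w + 1)" "1 - cayley w = 2 / (w + 1)"
    by (simp_all add: cayley_def field_simps)
  then show ?thesis using \<open>w + 1 \<noteq> 0\<close> by simp
qed

text \<open>Combined with \<open>cayley_deriv\<close>, this turns \<open>(1 - |z|^2) |F'(z)|\<close>
  into \<open>2 * Re w\<close> times the modulus of the derivative of
  \<open>F \<circ> cayley\<close> at \<open>w\<close>.\<close>

lemma one_minus_norm_cayley:
  assumes "Re w > 0"
  shows "1 - (cmod (cayley w))\<^sup>2 = 4 * Re w / (cmod (w + 1))\<^sup>2"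
proof -
  have "w + 1 \<noteq> 0" using assms by (auto simp: complex_eq_iff)
  then have "1 - (cmod (cayley w))\<^sup>2 = ((cmod (w + 1))\<^sup>2 - (cmod (w - 1))\<^sup>2) / (cmod (w + 1))\<^sup>2"
    by (simp add: cayley_def norm_divide power_divide diff_divide_distrib[of "x\<^sup>2" for x])
  also have "(cmod (w + 1))\<^sup>2 - (cmod (w - 1))\<^sup>2 = 4 * Re w"
    unfolding cmod_power2 by (simp add: power2_eq_square algebra_simps)
  finally show ?thesis .
qed

lemma cayley_in_disc:
  assumes "Re w > 0"
  shows "cayley w \<in> ball 0 1"
proof -
  have "w + 1 \<noteq> 0" using assms by (auto simp: complex_eq_iff)
  then have "4 * Re w / (cmod (w + 1))\<^sup>2 > 0" using assms by simp
  then have "(cmod (cayley w))\<^sup>2 < 1" using one_minus_norm_cayley[OF assms] by linarith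
  then show ?thesis by (simp add: abs_square_less_1)
qed

lemma cayley_deriv:
  assumes "Re w > 0"
  shows "(cayley has_field_derivative 2 / (w + 1)\<^sup>2) (at w)"
proof -
  have "w + 1 \<noteq> 0" using assms by (auto simp: complex_eq_iff)
  then show ?thesis unfolding cayley_def
    by (auto intro!: derivative_eq_intros simp: power2_eq_square)
qed

text \<open>Large \<open>|w|\<close> corresponds to \<open>z\<close> near 1, where \<open>f\<close>
  is known to be large. The distance equals \<open>2 / |w + 1|\<close>, and
  \<open>|w + 1| > |w|\<close> in the half-plane.\<close>

lemma dist_cayley_one:
  assumes "Re w > 0"
  shows "dist (cayley w) 1 < 2 / cmod w"
proof -
  have nz: "w + 1 \<noteq> 0" "w \<noteq> 0" using assms by (auto simp: complex_eq_iff)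
  have "cayley w - 1 = - 2 / (w + 1)" using nz by (simp add: cayley_def field_simps)
  then have "dist (cayley w) 1 = 2 / cmod (w + 1)" by (simp add: dist_norm norm_divide)
  moreover have "(cmod w)\<^sup>2 < (cmod (w + 1))\<^sup>2"
    unfolding cmod_power2 using assms by (simp add: power2_eq_square algebra_simps)
  then have "cmod w < cmod (w + 1)" by (rule power2_less_imp_less) simp
  ultimately show ?thesis using nz by (simp add: divide_strict_left_mono)
qed

lemma holomorphic_cayley: "cayley holomorphic_on {w. Re w > 0}"
  using cayley_deriv open_halfspace_Re_gt[of 0] by (auto simp: holomorphic_on_open)

lemma holomorphic_singular_inner: "singular_inner holomorphic_on unit_disc"
  unfolding singular_inner_def by (intro holomorphic_intros) auto

section \<open>Unboundedness of the spherical derivative\<close>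

lemma spherical_deriv_unbounded:
  fixes f F :: "complex \<Rightarrow> complex"
  assumes f: "f holomorphic_on unit_disc"
    and f_top: "filterlim (\<lambda>z. cmod (f z)) at_top (at 1 within unit_disc)"
    and f_radial: "\<forall>\<^sub>F r in at_left 1. cmod (f (complex_of_real r)) \<le> exp ((1 + r) / (1 - r))"
    and F: "\<And>z. z \<in> unit_disc \<Longrightarrow> F z = singular_inner z * f z"
  shows "\<exists>z\<in>unit_disc. (1 - (cmod z)\<^sup>2) * (cmod (deriv F z) / (1 + (cmod (F z))\<^sup>2)) > C"
proof (rule ccontr)
  assume "\<not> ?thesis"
  then have bound: "(1 - (cmod z)\<^sup>2) * (cmod (deriv F z) / (1 + (cmod (F z))\<^sup>2)) \<le> C"
    if "z \<in> unit_disc" for z using that by (auto simp: not_less)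
  have "C \<ge> 0" using bound[of 0] by simp (smt (verit) divide_nonneg_nonneg norm_ge_zero zero_le_power2)
  define M where "M = C + 3" \<comment> \<open>the error terms at the end cost at most 2\<close>
  define g where "g = f \<circ> cayley"
  have F_cayley: "F (cayley w) = exp (- w) * g w" if "Re w > 0" for w
    using F[OF cayley_in_disc[OF that]] cayley_inverse[OF that]
    by (simp add: singular_inner_def g_def)
  have holg: "g holomorphic_on {w. Re w > 0}" unfolding g_def
    by (rule holomorphic_on_compose_gen[OF holomorphic_cayley f]) (use cayley_in_disc in auto)
  have "(\<lambda>z. singular_inner z * f z) holomorphic_on unit_disc"
    by (intro holomorphic_intros holomorphic_singular_inner f)
  then have holF: "F holomorphic_on unit_disc"
    by (rule holomorphic_transform) (simp add: F)

  from f_top have "\<forall>\<^sub>F z in at 1 within unit_disc. cmod (f z) > exp M"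
    by (simp add: filterlim_at_top_dense)
  then obtain d where "d > 0"
    and d: "\<And>z. z \<in> unit_disc \<Longrightarrow> dist z 1 < d \<Longrightarrow> cmod (f z) > exp M"
    unfolding eventually_at by (metis dist_0_norm less_irrefl mem_ball norm_one)
  \<comment> \<open>Beyond \<open>2 / d\<close> the point \<open>cayley w\<close> is within
    \<open>d\<close> of 1. The bound \<open>R \<ge> 1\<close> serves the later estimates
    \<open>R \<le> R^2\<close> and \<open>q \<le> q * |w|\<close>.\<close>
  define R where "R = max 1 (2 / d)"
  have R: "R \<ge> 1" "2 / d \<le> R" by (auto simp: R_def)
  have g_big: "cmod (g w) > exp M" if "Re w > 0" "cmod w > R" for w
  proof -
    have "2 / d < cmod w" using that R by linarith
    moreover have "cmod w > 0" using that R by linarith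
    ultimately have "2 / cmod w < d" using \<open>d > 0\<close> by (simp add: field_simps)
    then have "dist (cayley w) 1 < d" using dist_cayley_one[OF that(1)] by linarith
    then show ?thesis using d[OF cayley_in_disc[OF that(1)]] by (simp add: g_def)
  qed
  obtain b where "b < 1"
    and b: "\<And>r. b < r \<Longrightarrow> r < 1 \<Longrightarrow> cmod (f (complex_of_real r)) \<le> exp ((1 + r) / (1 - r))"
    using f_radial unfolding eventually_at_left_field by blast

  \<comment> \<open>The points found below satisfy \<open>|w| \<ge> \<rho> / 2\<close>, so
    \<open>\<rho> > 4 R^2\<close> yields \<open>R^2 / |w| \<le> 1 / 2\<close>. The other term places
    the real point \<open>cayley \<rho>\<close> beyond \<open>b\<close>.\<close>
  define \<rho> where "\<rho> = max (4 * R\<^sup>2) (2 / (1 - b)) + 1"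
  have \<rho>: "\<rho> > 4 * R\<^sup>2" "\<rho> > 2 / (1 - b)" by (auto simp: \<rho>_def)
  have "R \<le> R\<^sup>2" using R by (simp add: power2_eq_square)
  with \<rho> R have \<rho>1: "\<rho> > 1" "\<rho> > 2 * R" by linarith+
  have F_real: "cmod (F (cayley (of_real \<rho>))) \<le> 1"
  proof -
    define r where "r = (\<rho> - 1) / (\<rho> + 1)"
    have r: "cayley (of_real \<rho>) = of_real r" by (simp add: r_def cayley_def)
    have "1 - r = 2 / (\<rho> + 1)" using \<rho>1 by (simp add: r_def field_simps)
    moreover have "2 / (\<rho> + 1) < 1 - b" using \<rho> \<rho>1 \<open>b < 1\<close>
      by (simp add: field_simps)
    ultimately have "b < r" by linarith
    moreover have "r < 1" using \<rho>1 by (simp add: r_def)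
    ultimately have "cmod (f (of_real r)) \<le> exp ((1 + r) / (1 - r))" by (rule b)
    moreover have "(1 + r) / (1 - r) = \<rho>"
      using \<rho>1 by (simp add: r_def field_simps)
    ultimately have "cmod (g (of_real \<rho>)) \<le> exp \<rho>" by (simp add: g_def r)
    then have "exp (- \<rho>) * cmod (g (of_real \<rho>)) \<le> exp (- \<rho>) * exp \<rho>"
      by (intro mult_left_mono) auto
    then show ?thesis using F_cayley[of "of_real \<rho>"] \<rho>1
      by (simp add: norm_mult mult_exp_exp)
  qed

  \<comment> \<open>The segment from \<open>\<rho>\<close> to \<open>1 + i \<rho>\<close>. On it
    \<open>Re + Im = \<rho> + t\<close>, so one of the two coordinates is at least
    \<open>\<rho> / 2\<close>.\<close>
  define \<gamma> where "\<gamma> t = Complex ((1 - t) * \<rho> + t) (t * \<rho>)" for t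
  have \<gamma>: "Re (\<gamma> t) > 0" "cmod (\<gamma> t) \<ge> \<rho> / 2" if "t \<in> {0..1}" for t
  proof -
    have "(1 - t) * (\<rho> - 1) \<ge> 0" using that \<rho>1 by simp
    then have "Re (\<gamma> t) \<ge> 1" by (simp add: \<gamma>_def algebra_simps)
    then show "Re (\<gamma> t) > 0" by linarith
    have "Re (\<gamma> t) \<le> cmod (\<gamma> t)" "Im (\<gamma> t) \<le> cmod (\<gamma> t)"
      using complex_Re_le_cmod abs_Im_le_cmod abs_le_D1 by blast+
    moreover have "Re (\<gamma> t) + Im (\<gamma> t) = \<rho> + t" by (simp add: \<gamma>_def algebra_simps)
    ultimately show "cmod (\<gamma> t) \<ge> \<rho> / 2" using that by simp
  qed
  have "\<exists>t\<ge>0. t \<le> 1 \<and> cmod (F (cayley (\<gamma> t))) = 1"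
  proof (rule IVT')
    show "cmod (F (cayley (\<gamma> 0))) \<le> 1"
      using F_real by (simp add: \<gamma>_def flip: complex_of_real_def)
    have Re1: "Re (\<gamma> 1) = 1" by (simp add: \<gamma>_def)
    \<comment> \<open>At the far end \<open>|exp (- w)| = exp (- 1)\<close>, while
      \<open>M \<ge> 1\<close> gives \<open>|g| > exp 1\<close>; hence
      \<open>|F| \<ge> 1\<close>.\<close>
    have "cmod (g (\<gamma> 1)) > exp M" using \<gamma>[of 1] \<rho>1 by (intro g_big) auto
    moreover have "exp M \<ge> exp 1" using \<open>C \<ge> 0\<close> by (simp add: M_def)
    ultimately have "cmod (g (\<gamma> 1)) \<ge> exp 1" by linarith
    then have "exp (- 1) * cmod (g (\<gamma> 1)) \<ge> exp (- 1) * exp 1"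
      by (intro mult_left_mono) auto
    then show "1 \<le> cmod (F (cayley (\<gamma> 1)))"
      using F_cayley[of "\<gamma> 1"] Re1 by (simp add: norm_mult mult_exp_exp)
    have cont_\<gamma>: "continuous_on {0..1} \<gamma>" unfolding \<gamma>_def
      by (subst continuous_on_cong[OF refl Complex_eq]) (intro continuous_intros)
    have "continuous_on {w. Re w > 0} (\<lambda>w. F (cayley w))"
      by (rule continuous_on_compose2[OF holomorphic_on_imp_continuous_on[OF holF]
            holomorphic_on_imp_continuous_on[OF holomorphic_cayley]])
        (use cayley_in_disc in auto)
    then have "continuous_on {0..1} (\<lambda>t. F (cayley (\<gamma> t)))"
      by (rule continuous_on_compose2[OF _ cont_\<gamma>]) (use \<gamma> in auto)
    then show "continuous_on {0..1} (\<lambda>t. cmod (F (cayley (\<gamma> t))))"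
      by (rule continuous_on_norm)
  qed simp
  then obtain w where w: "Re w > 0" "cmod w \<ge> \<rho> / 2" and F1: "cmod (F (cayley w)) = 1"
    using \<gamma> by (metis atLeastAtMost_iff)
  have w': "cmod w > R" "cmod w \<ge> 2 * R\<^sup>2" using w \<rho> \<rho>1 by linarith+
  define x where "x = Re w"
  define q where "q = R\<^sup>2 / (cmod w)\<^sup>2"
  have "x > 0" using w by (simp add: x_def)
  have gw: "cmod (g w) = exp x"
    using F1 F_cayley[OF w(1)] by (simp add: norm_mult norm_divide x_def exp_minus field_simps)
  then have "exp M < exp x" using g_big[OF w(1) w'(1)] by simp
  then have "M < x" by simp
  have w_pos: "cmod w > 0" using w' R by linarith
  have Rw: "R\<^sup>2 / cmod w \<le> 1 / 2" using w' w_pos by (simp add: field_simps)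
  \<comment> \<open>The bound on \<open>q * x\<close> is the crucial one: \<open>x\<close> may be
    large, yet the distortion factor then changes \<open>x - M\<close> only by a bounded
    amount.\<close>
  have q: "q \<ge> 0" "q * x \<le> 1 / 2" "q \<le> 1 / 2"
  proof -
    show "q \<ge> 0" by (simp add: q_def)
    have "q * x \<le> q * cmod w"
      unfolding x_def using \<open>q \<ge> 0\<close> by (intro mult_left_mono complex_Re_le_cmod)
    also have qw: "q * cmod w = R\<^sup>2 / cmod w" using w_pos by (simp add: q_def power2_eq_square)
    finally show "q * x \<le> 1 / 2" using Rw by linarith
    have "q * 1 \<le> q * cmod w" using \<open>q \<ge> 0\<close> w' R by (intro mult_left_mono) auto
    then show "q \<le> 1 / 2" using qw Rw by linarith
  qed

  have log_deriv_g: "cmod (deriv g w / g w) \<le> (x - M) / x * ((1 + q) / (1 - q))"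
  proof -
    have "g holomorphic_on {w. Re w > 0 \<and> cmod w > R}"
      by (rule holomorphic_on_subset[OF holg]) auto
    then have "cmod (deriv g w / g w) \<le> (ln (cmod (g w)) - ln (exp M)) / Re w * ((1 + q) / (1 - q))"
      unfolding q_def by (rule log_deriv_bound_half_plane_minus_disc) (use R w w' g_big in auto)
    then show ?thesis by (simp add: gw x_def)
  qed
  \<comment> \<open>After multiplication by \<open>1 - q\<close> the two sides differ by
    \<open>2 q (1 - 2 q)\<close>, nonnegative for \<open>q \<le> 1 / 2\<close>. The resulting error
    \<open>4 q (x - M)\<close> is at most 2.\<close>
  have "(1 + q) / (1 - q) \<le> 1 + 4 * q"
  proof -
    have "0 \<le> q * (1 - 2 * q)" using q by simp
    then show ?thesis using q by (simp add: field_simps)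
  qed
  then have "(x - M) * ((1 + q) / (1 - q)) \<le> (x - M) * (1 + 4 * q)"
    using \<open>M < x\<close> by (intro mult_left_mono) auto
  also have "\<dots> = x - M + 4 * (q * x) - 4 * (q * M)" by (simp add: algebra_simps)
  also have "\<dots> \<le> x - M + 2"
  proof -
    have "q * M \<ge> 0" using q \<open>C \<ge> 0\<close> by (simp add: M_def)
    then show ?thesis using q by linarith
  qed
  finally have upper: "x * cmod (deriv g w / g w) \<le> x - M + 2"
    using mult_left_mono[OF log_deriv_g, of x] \<open>x > 0\<close> by simp

  \<comment> \<open>The derivative of \<open>F \<circ> cayley\<close> at \<open>w\<close>, computed
    in two ways: by the chain rule, and from the product \<open>exp (- w) * g w\<close>.\<close>
  define D where "D = deriv F (cayley w) * (2 / (w + 1)\<^sup>2)"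
  have dF: "((F \<circ> cayley) has_field_derivative D) (at w)"
    unfolding D_def
    by (rule DERIV_chain[OF holomorphic_derivI[OF holF open_ball cayley_in_disc[OF w(1)]]
          cayley_deriv[OF w(1)]])
  have dg: "(g has_field_derivative deriv g w) (at w)"
    by (rule holomorphic_derivI[OF holg open_halfspace_Re_gt]) (use w in auto)
  have "((\<lambda>w. exp (- w) * g w) has_field_derivative exp (- w) * (deriv g w - g w)) (at w)"
    by (auto intro!: derivative_eq_intros dg simp: algebra_simps)
  then have "((F \<circ> cayley) has_field_derivative exp (- w) * (deriv g w - g w)) (at w)"
    by (rule has_field_derivative_transform_within_open[OF _ open_halfspace_Re_gt[of 0]])
      (use w F_cayley in auto)
  then have "D = exp (- w) * (deriv g w - g w)" using dF DERIV_unique by blast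
  also have "\<dots> = F (cayley w) * (deriv g w / g w - 1)"
  proof -
    have "g w \<noteq> 0" using gw by auto
    then show ?thesis using F_cayley[OF w(1)] by (simp add: field_simps)
  qed
  finally have "cmod D = cmod (1 - deriv g w / g w)"
    by (simp add: norm_mult F1 norm_minus_commute)
  then have "cmod D \<ge> 1 - cmod (deriv g w / g w)"
    using norm_triangle_ineq2[of 1 "deriv g w / g w"] by simp
  then have "x * cmod D \<ge> x - x * cmod (deriv g w / g w)"
    using mult_left_mono[of "1 - cmod (deriv g w / g w)" "cmod D" x] \<open>x > 0\<close>
    by (simp add: right_diff_distrib)
  \<comment> \<open>The two occurrences of \<open>x\<close> cancel, leaving
    \<open>M - 2 = C + 1\<close>, which exceeds \<open>C\<close>.\<close>
  with upper have "x * cmod D \<ge> M - 2" by linarith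
  \<comment> \<open>Since \<open>|F| = 1\<close>, the denominator \<open>1 + |F|^2\<close> is 2 and
    absorbs the factor 2 from the change of variable, so \<open>x * |D|\<close> is exactly the
    quantity bounded by \<open>C\<close>.\<close>
  moreover have "x * cmod D \<le> C"
  proof -
    have "x * cmod D = (1 - (cmod (cayley w))\<^sup>2) * (cmod (deriv F (cayley w)) / (1 + (cmod (F (cayley w)))\<^sup>2))"
      unfolding one_minus_norm_cayley[OF w(1)] F1
      by (simp add: D_def x_def norm_mult norm_divide norm_power)
    then show ?thesis using bound[OF cayley_in_disc[OF w(1)]] by simp
  qed
  ultimately show False by (simp add: M_def)
qed

section \<open>Infinite suprema and the conclusion\<close>

text \<open>A finite supremum would be \<open>ennreal C\<close> with \<open>C \<ge> 0\<close>. Since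
  \<open>ennreal\<close> truncates only negative reals, a value \<open>h z > C\<close> contradicts
  this.\<close>

lemma SUP_ennreal_unbounded:
  assumes "\<And>C. \<exists>z\<in>A. h z > C"
  shows "(SUP z\<in>A. ennreal (h z)) = \<infinity>"
proof (rule ccontr)
  assume "\<not> ?thesis"
  then obtain C where C: "C \<ge> 0" "(SUP z\<in>A. ennreal (h z)) = ennreal C"
    by (cases "SUP z\<in>A. ennreal (h z)") auto
  obtain z where z: "z \<in> A" "h z > C" using assms by blast
  have "ennreal (h z) \<le> ennreal C" unfolding C(2)[symmetric] by (rule SUP_upper[OF z(1)])
  then show False using z C(1) by (simp add: ennreal_le_iff)
qed

theorem theorem1p2:
  fixes f F :: "complex \<Rightarrow> complex"
  assumes "f holomorphic_on unit_disc"
    and "filterlim (\<lambda>z. cmod (f z)) at_top (at 1 within unit_disc)"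
    and "(\<lambda>r::real. cmod (f (complex_of_real r))) \<in> o[at_left 1](\<lambda>r. exp ((1 + r) / (1 - r)))"
    and "\<And>z. z \<in> unit_disc \<Longrightarrow> F z = singular_inner z * f z"
  shows "\<not> normal_function F \<and> \<not> bloch_function F"
proof -
  have "(\<lambda>z. singular_inner z * f z) holomorphic_on unit_disc"
    by (intro holomorphic_intros holomorphic_singular_inner assms(1))
  then have "F holomorphic_on unit_disc"
    by (rule holomorphic_transform) (simp add: assms(4))
  then have analytic: "{z \<in> unit_disc. F analytic_on {z}} = unit_disc"
    using analytic_at open_ball by blast
  \<comment> \<open>The little-o condition with constant 1, which amounts to
    \<open>|F r| \<le> 1\<close> for real \<open>r\<close> close to 1.\<close>
  have "\<forall>\<^sub>F r in at_left 1. cmod (f (complex_of_real r)) \<le> exp ((1 + r) / (1 - r))"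
    using landau_o.smallD[OF assms(3), of 1] by simp
  note unbounded = spherical_deriv_unbounded[OF assms(1,2) this assms(4)]
  have "\<not> normal_function F"
    unfolding normal_function_def analytic
    by (subst SUP_ennreal_unbounded[OF unbounded]) auto
  \<comment> \<open>The denominator \<open>1 + |F|^2\<close> is at least 1, so the Bloch quantity
    dominates the spherical one; this is why Bloch functions are normal.\<close>
  moreover have "\<exists>z\<in>unit_disc. (1 - (cmod z)\<^sup>2) * cmod (deriv F z) > C" for C
  proof -
    obtain z where z: "z \<in> unit_disc"
      and C: "(1 - (cmod z)\<^sup>2) * (cmod (deriv F z) / (1 + (cmod (F z))\<^sup>2)) > C"
      using unbounded by blast
    have "cmod (deriv F z) / (1 + (cmod (F z))\<^sup>2) \<le> cmod (deriv F z)"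
      by (simp add: field_simps add_pos_nonneg)
    moreover have "1 - (cmod z)\<^sup>2 \<ge> 0" using z by (simp add: abs_square_le_1)
    ultimately have "(1 - (cmod z)\<^sup>2) * (cmod (deriv F z) / (1 + (cmod (F z))\<^sup>2))
        \<le> (1 - (cmod z)\<^sup>2) * cmod (deriv F z)"
      by (rule mult_left_mono)
    with C z show ?thesis by force
  qed
  then have "\<not> bloch_function F"
    unfolding bloch_function_def by (subst SUP_ennreal_unbounded) auto
  ultimately show ?thesis by blast
qed

end
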